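(* Let $\mathcal{H}$ be a complex Hilbert space and let $A,B\in L(\mathcal{H})$. Then the following assertions are equivalent: (1) $A$ is below $B$ in the minus order, i.e. there exist $P,Q\in L(\mathcal{H})$ with $P^2=P$, $Q^2=Q$, $A=PB$ and $A^*=QB^*$; (2) $R(B)=R(A)\dotplus R(B-A)$ and $R(B^* )=R(A^* )\dotplus R(B^*-A^* )$.
   Context: $L(\mathcal{H})$ is the algebra of bounded linear operators on $\mathcal{H}$, $R(T)$ is the range of $T$, and $\dotplus$ denotes a direct (algebraic) sum of linear subspaces, i.e. a sum of two subspaces with trivial intersection (not necessarily orthogonal, and the subspaces need not be closed). *)

theory Defs
  imports "HOL-Analysis.Analysis" "HOL-Library.Set_Algebras"
begin

section \<open>Complex Hilbert spaces\<close>

text \<open>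
  The class extends \<^class>\<open>real_inner\<close>, so that the norm, topology and real-linear theory of the
  library apply. The real data are determined by the complex ones: real scalars act through
  \<^const>\<open>of_real\<close>, and the real inner product is the real part of the Hermitian one. Positive
  definiteness and \<open>norm x ^ 2 = cinner x x\<close> (lemma \<open>cinner_self\<close> below) follow from this.
  The Hermitian form is linear in its first argument.
\<close>

class complex_inner = real_inner +
  fixes scaleC :: "complex \<Rightarrow> 'a \<Rightarrow> 'a"  (infixr \<open>*\<^sub>C\<close> 75)
    and cinner :: "'a \<Rightarrow> 'a \<Rightarrow> complex"
  assumes scaleC_add_right: "c *\<^sub>C (x + y) = c *\<^sub>C x + c *\<^sub>C y"
    and scaleC_add_left: "(c + d) *\<^sub>C x = c *\<^sub>C x + d *\<^sub>C x"
    and scaleC_scaleC: "c *\<^sub>C d *\<^sub>C x = (c * d) *\<^sub>C x"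
    and scaleC_one: "1 *\<^sub>C x = x"
    and scaleR_scaleC: "r *\<^sub>R x = complex_of_real r *\<^sub>C x"
    and cinner_commute: "cinner x y = cnj (cinner y x)"
    and cinner_add_left: "cinner (x + y) z = cinner x z + cinner y z"
    and cinner_scaleC_left: "cinner (c *\<^sub>C x) y = c * cinner x y"
    and inner_eq_Re_cinner: "inner x y = Re (cinner x y)"

class complex_hilbert_space = complex_inner + complete_space

subclass (in complex_hilbert_space) banach ..

instantiation complex :: complex_hilbert_space
begin

definition scaleC_complex :: "complex \<Rightarrow> complex \<Rightarrow> complex"
  where "scaleC_complex c x = c * x"

definition cinner_complex :: "complex \<Rightarrow> complex \<Rightarrow> complex"
  where "cinner_complex x y = x * cnj y"

instance
  by standard (auto simp: scaleC_complex_def cinner_complex_def algebra_simps inner_complex_def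
      scaleR_conv_of_real)

end

lemma cinner_self: "cinner x x = complex_of_real ((norm x)\<^sup>2)"
  for x :: "'a::complex_inner"
proof (rule complex_eqI)
  show "Re (cinner x x) = Re (complex_of_real ((norm x)\<^sup>2))"
    by (simp add: inner_eq_Re_cinner[symmetric] power2_norm_eq_inner)
  have "Im (cinner x x) = - Im (cinner x x)"
    by (subst cinner_commute) simp
  then show "Im (cinner x x) = Im (complex_of_real ((norm x)\<^sup>2))"
    by simp
qed

lemma cinner_add_right: "cinner x (y + z) = cinner x y + cinner x z"
  for x y z :: "'a::complex_inner"
  by (simp add: cinner_commute[of x] cinner_add_left)

lemma cinner_scaleC_right: "cinner x (c *\<^sub>C y) = cnj c * cinner x y"
  for x y :: "'a::complex_inner"
  by (simp add: cinner_commute[of x] cinner_scaleC_left)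

lemma Im_cinner: "Im (cinner x y) = - inner (\<i> *\<^sub>C x) y"
  for x y :: "'a::complex_inner"
  by (simp add: inner_eq_Re_cinner cinner_scaleC_left)

lemma cinner_right_eqI:
  fixes y z :: "'a::complex_inner"
  assumes "\<And>x. cinner x y = cinner x z"
  shows "y = z"
proof -
  have "inner (y - z) y = inner (y - z) z"
    using assms[of "y - z"] by (simp only: inner_eq_Re_cinner)
  then have "inner (y - z) (y - z) = 0"
    by (simp add: inner_diff_right)
  then show ?thesis
    by simp
qed

section \<open>Bounded operators and adjoints\<close>

definition bounded_ops :: "('a::complex_hilbert_space \<Rightarrow> 'a) set"
  where "bounded_ops = {T. bounded_linear T \<and> (\<forall>c x. T (c *\<^sub>C x) = c *\<^sub>C T x)}"

definition cadjoint :: "('a::complex_hilbert_space \<Rightarrow> 'a) \<Rightarrow> 'a \<Rightarrow> 'a"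
  where "cadjoint T = (THE S. \<forall>x y. cinner (T x) y = cinner x (S y))"

text \<open>
  Existence of the adjoint rests on the Riesz representation theorem, obtained here by
  minimising \<open>norm x ^ 2 - 2 * f x\<close>.
\<close>

lemma riesz_representation_real:
  fixes f :: "'a::{real_inner,complete_space} \<Rightarrow> real"
  assumes f: "bounded_linear f"
  shows "\<exists>z. \<forall>x. f x = inner x z"
proof -
  interpret f: bounded_linear f by (rule f)
  define g where "g x = (norm x)\<^sup>2 - 2 * f x" for x
  obtain K where K: "\<And>x. norm (f x) \<le> norm x * K"
    using f.bounded by blast
  have lower: "g x \<ge> - K\<^sup>2" for x
  proof -
    have "f x \<le> norm x * K"
      using K[of x] by auto
    moreover have "0 \<le> (norm x - K)\<^sup>2"
      by simp
    ultimately show ?thesis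
      by (simp add: g_def power2_eq_square algebra_simps)
  qed
  define m where "m = Inf (range g)"
  have bdd: "bdd_below (range g)"
    using lower by (auto intro!: bdd_belowI)
  have m_le: "m \<le> g x" for x
    unfolding m_def using bdd by (auto intro: cInf_lower)
  have "\<exists>x. g x < m + inverse (real (Suc n))" for n
  proof -
    have "Inf (range g) < m + inverse (real (Suc n))"
      unfolding m_def by simp
    then show ?thesis
      using cInf_lessD[of "range g"] by auto
  qed
  then obtain X where X: "\<And>n. g (X n) < m + inverse (real (Suc n))"
    by metis
  have para: "(norm (x - y))\<^sup>2 = 2 * g x + 2 * g y - 4 * g ((1/2) *\<^sub>R (x + y))" for x y
    by (simp add: g_def f.scaleR f.add power2_norm_eq_inner inner_diff_left inner_diff_right
        inner_add_left inner_add_right inner_commute algebra_simps)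
  have dist: "(norm (X p - X q))\<^sup>2 < 2 * inverse (real (Suc p)) + 2 * inverse (real (Suc q))" for p q
    using para[of "X p" "X q"] X[of p] X[of q] m_le[of "(1/2) *\<^sub>R (X p + X q)"] by linarith
  have "Cauchy X"
  proof (rule metric_CauchyI)
    fix e :: real
    assume "0 < e"
    then have "0 < e\<^sup>2 / 4"
      by simp
    then obtain N where N: "inverse (real (Suc N)) < e\<^sup>2 / 4"
      using reals_Archimedean by blast
    have "dist (X p) (X q) < e" if "p \<ge> N" "q \<ge> N" for p q
    proof -
      have "inverse (real (Suc p)) \<le> inverse (real (Suc N))"
        "inverse (real (Suc q)) \<le> inverse (real (Suc N))"
        using that by (auto intro!: le_imp_inverse_le)
      then have "(norm (X p - X q))\<^sup>2 < e\<^sup>2"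
        using dist[of p q] N by linarith
      then show ?thesis
        using \<open>0 < e\<close> by (simp add: dist_norm power_less_imp_less_base)
    qed
    then show "\<exists>M. \<forall>p\<ge>M. \<forall>q\<ge>M. dist (X p) (X q) < e"
      by blast
  qed
  then obtain z where z: "X \<longlonglongrightarrow> z"
    using Cauchy_convergent convergent_def by blast
  have "(\<lambda>n. g (X n)) \<longlonglongrightarrow> g z"
    unfolding g_def by (intro tendsto_intros z f.tendsto)
  moreover have "(\<lambda>n. m + inverse (real (Suc n))) \<longlonglongrightarrow> m + 0"
    by (intro tendsto_intros LIMSEQ_inverse_real_of_nat)
  ultimately have "g z \<le> m + 0"
    by (rule LIMSEQ_le) (use X less_imp_le in blast)
  then have min: "g z \<le> g x" for x
    using m_le[of x] by simp
  have "f x = inner x z" for x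
  proof (rule ccontr)
    assume neq: "f x \<noteq> inner x z"
    define d where "d = f x - inner x z"
    have "d \<noteq> 0"
      using neq by (simp add: d_def)
    have "x \<noteq> 0"
      using neq f.zero by auto
    then have pos: "inner x x > 0"
      by simp
    define t where "t = d / inner x x"
    have "g (z + t *\<^sub>R x) = g z + t * (t * inner x x) - 2 * t * d"
      by (simp add: g_def d_def f.scaleR f.add power2_norm_eq_inner
          inner_add_left inner_add_right inner_commute algebra_simps)
    also have "t * inner x x = d"
      using pos by (simp add: t_def)
    finally have "t * d \<le> 0"
      using min[of "z + t *\<^sub>R x"] by (simp add: algebra_simps)
    moreover have "t * d > 0"
    proof -
      have "t * d = d\<^sup>2 / inner x x"
        by (simp add: t_def power2_eq_square)
      also have "\<dots> > 0"
        using pos \<open>d \<noteq> 0\<close> by (intro divide_pos_pos) simp_all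
      finally show ?thesis .
    qed
    ultimately show False
      by simp
  qed
  then show ?thesis
    by blast
qed

lemma cadjoint:
  fixes T :: "'a::complex_hilbert_space \<Rightarrow> 'a"
  assumes "T \<in> bounded_ops"
  shows "cinner (T x) y = cinner x (cadjoint T y)"
proof -
  have T: "bounded_linear T" and TC: "\<And>c x. T (c *\<^sub>C x) = c *\<^sub>C T x"
    using assms by (auto simp: bounded_ops_def)
  have "\<exists>z. \<forall>x. inner (T x) y = inner x z" for y
    by (rule riesz_representation_real)
      (rule bounded_linear_compose[OF bounded_linear_inner_left T])
  then obtain S where S: "\<And>x y. inner (T x) y = inner x (S y)"
    by metis
  have adj: "\<forall>x y. cinner (T x) y = cinner x (S y)"
    using S by (auto intro!: complex_eqI simp: Im_cinner TC[symmetric])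
      (simp add: inner_eq_Re_cinner[symmetric])
  have "cadjoint T = S"
    unfolding cadjoint_def
  proof (rule the_equality)
    fix S'
    assume S': "\<forall>x y. cinner (T x) y = cinner x (S' y)"
    show "S' = S"
    proof (rule ext, rule cinner_right_eqI)
      show "cinner x (S' y) = cinner x (S y)" for x y
        using S'[rule_format, of x y] adj[rule_format, of x y] by (rule trans[OF sym])
    qed
  qed (rule adj)
  then show ?thesis
    using adj by simp
qed

lemma cadjoint_in_bounded_ops:
  fixes T :: "'a::complex_hilbert_space \<Rightarrow> 'a"
  assumes "T \<in> bounded_ops"
  shows "cadjoint T \<in> bounded_ops"
proof -
  note adj = cadjoint[OF assms, symmetric]
  have T: "bounded_linear T"
    using assms by (simp add: bounded_ops_def)
  obtain K where K: "\<And>x. norm (T x) \<le> norm x * K" "K \<ge> 0"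
    using bounded_linear.nonneg_bounded[OF T] by blast
  have add: "cadjoint T (x + y) = cadjoint T x + cadjoint T y" for x y
    by (rule cinner_right_eqI) (simp add: adj cinner_add_right)
  have scale: "cadjoint T (c *\<^sub>C x) = c *\<^sub>C cadjoint T x" for c x
    by (rule cinner_right_eqI) (simp add: adj cinner_scaleC_right)
  have bound: "norm (cadjoint T y) \<le> norm y * K" for y
  proof (cases "cadjoint T y = 0")
    case True
    then show ?thesis
      using K(2) by simp
  next
    case False
    have "norm (cadjoint T y) * norm (cadjoint T y) = inner (T (cadjoint T y)) y"
      by (simp add: inner_eq_Re_cinner adj[symmetric] cinner_self power2_eq_square)
    also have "\<dots> \<le> norm (T (cadjoint T y)) * norm y"
      by (rule norm_cauchy_schwarz)
    also have "\<dots> \<le> norm (cadjoint T y) * K * norm y"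
      by (intro mult_right_mono K) simp
    finally show ?thesis
      using False by (simp add: mult.assoc mult.commute)
  qed
  have "bounded_linear (cadjoint T)"
    by (rule bounded_linear_intro[where K = K]) (simp_all add: add scale scaleR_scaleC bound)
  then show ?thesis
    using scale by (simp add: bounded_ops_def)
qed

section \<open>Direct sums and the minus order\<close>

text \<open>
  In the following definition \<open>M + N\<close> is the set of all sums \<open>x + y\<close> with \<open>x \<in> M\<close> and \<open>y \<in> N\<close>.
  The sum is purely algebraic: neither closedness nor orthogonality is required.
\<close>

definition csubspace :: "'a::complex_inner set \<Rightarrow> bool"
  where "csubspace M \<longleftrightarrow>
    0 \<in> M \<and> (\<forall>x\<in>M. \<forall>y\<in>M. x + y \<in> M) \<and> (\<forall>c. \<forall>x\<in>M. c *\<^sub>C x \<in> M)"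

definition is_direct_sum :: "'a::complex_inner set \<Rightarrow> 'a set \<Rightarrow> 'a set \<Rightarrow> bool"
  where "is_direct_sum S M N \<longleftrightarrow>
    csubspace M \<and> csubspace N \<and> S = M + N \<and> M \<inter> N = {0}"

definition minus_le :: "('a::complex_hilbert_space \<Rightarrow> 'a) \<Rightarrow> ('a \<Rightarrow> 'a) \<Rightarrow> bool"
  where "minus_le A B \<longleftrightarrow>
    (\<exists>P\<in>bounded_ops. \<exists>Q\<in>bounded_ops.
      P \<circ> P = P \<and> Q \<circ> Q = Q \<and> A = P \<circ> B \<and> cadjoint A = Q \<circ> cadjoint B)"

end

theory Submission
  imports Defs
begin

text \<open>
  (2) implies (1): since \<open>R(A) \<subseteq> R(B)\<close>, Douglas' factorisation gives a bounded \<open>X\<close> with \<open>A = B X\<close>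
  and \<open>R(X)\<close> contained in the closure of \<open>R(B\<^sup>*)\<close>, on which \<open>B\<close> is injective. Comparing
  \<open>B X x = A X x + (B - A) X x\<close> with \<open>B X x = A x + 0\<close>, the direct sum yields \<open>A X = A\<close>, hence
  \<open>B X\<^sup>2 = A X = A = B X\<close> and \<open>X\<^sup>2 = X\<close>; thus \<open>Q = X\<^sup>*\<close> is a projection with \<open>A\<^sup>* = Q B\<^sup>*\<close>. The same
  argument for the adjoints gives \<open>P\<close>.
\<close>

section \<open>Uniform boundedness and orthogonal projections\<close>

text \<open>Baire category argument: the closed sets \<open>S n\<close> on which the whole family is
  bounded by \<open>n\<close> cover the space, so one of them contains a ball, and linearity carries
  the bound from this ball to the unit sphere.\<close>

lemma uniform_boundedness:
  fixes f :: "'i \<Rightarrow> 'a::banach \<Rightarrow> 'b::real_normed_vector"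
  assumes lin: "\<And>i. bounded_linear (f i)"
    and bdd: "\<And>x. \<exists>K. \<forall>i. norm (f i x) \<le> K"
  obtains C where "C \<ge> 0" "\<And>i x. norm (f i x) \<le> C * norm x"
proof -
  define S where "S n = {x. \<forall>i. norm (f i x) \<le> real n}" for n :: nat
  have closed: "closed (S n)" for n
  proof -
    have "S n = (\<Inter>i. {x. norm (f i x) \<le> real n})"
      by (auto simp: S_def)
    then show ?thesis
      by (auto intro!: closed_INT closed_Collect_le continuous_on_norm continuous_on_const
          intro: linear_continuous_on lin)
  qed
  have "\<exists>n. x \<in> S n" for x
  proof -
    obtain K where K: "\<And>i. norm (f i x) \<le> K"
      using bdd by blast
    obtain n where "K \<le> real n"
      using real_arch_simple by blast
    then have "norm (f i x) \<le> real n" for i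
      using K[of i] by linarith
    then show ?thesis
      by (auto simp: S_def)
  qed
  then have cover: "\<Union> (range S) = UNIV"
    by auto
  have "\<exists>n. interior (S n) \<noteq> {}"
  proof (rule ccontr)
    assume "\<not> ?thesis"
    then have empty: "closedin Met_TC.mtopology T \<and> Met_TC.mtopology interior_of T = {}"
      if "T \<in> range S" for T
      using that closed by auto
    have "Met_TC.mcomplete TYPE('a)"
      by (simp add: complete_UNIV)
    then have "Met_TC.mtopology interior_of (\<Union> (range S)) = {}"
      by (rule Met_TC.metric_Baire_category_alt) (use empty in auto)
    then show False
      by (simp add: cover)
  qed
  then obtain n a e where e: "e > 0" "cball a e \<subseteq> S n"
    by (meson all_not_in_conv mem_interior_cball)
  \<comment> \<open>For \<open>t = e / norm x\<close> both \<open>a\<close> and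
    \<open>a + t *\<^sub>R x\<close> lie in \<open>cball a e\<close>, so
    \<open>f i (t *\<^sub>R x)\<close>, a difference of two values of norm at most \<open>n\<close>,
    has norm at most \<open>2 * n\<close>. Dividing by \<open>t\<close> gives this constant.\<close>
  define C where "C = 2 * real n / e"
  have "norm (f i x) \<le> C * norm x" for i x
  proof (cases "x = 0")
    case True
    then show ?thesis
      using lin by (simp add: linear_simps)
  next
    case False
    interpret bounded_linear "f i" by (rule lin)
    define t where "t = e / norm x"
    have t: "t > 0"
      using e False by (simp add: t_def)
    have "a \<in> S n" "a + t *\<^sub>R x \<in> S n"
      using e False by (auto simp: t_def dist_norm intro!: subsetD[OF e(2)])
    then have "norm (f i a) \<le> n" "norm (f i (a + t *\<^sub>R x)) \<le> n"
      by (auto simp: S_def)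
    then have "norm (f i (a + t *\<^sub>R x) - f i a) \<le> 2 * n"
      by (intro norm_triangle_le_diff) simp
    then have "t * norm (f i x) \<le> 2 * n"
      using t by (simp add: add scaleR)
    then show ?thesis
      using e False by (simp add: t_def C_def field_simps)
  qed
  moreover have "C \<ge> 0"
    using e by (simp add: C_def)
  ultimately show ?thesis
    using that by blast
qed

text \<open>The point \<open>p\<close> is a nearest point of \<open>M\<close> to \<open>x\<close>.
  It exists because near-minimisers of the distance cluster by the parallelogram law, and it is
  orthogonal because moving along \<open>M\<close> cannot reduce the distance.\<close>

lemma orthogonal_projection_exists:
  fixes M :: "'a::{real_inner,complete_space} set"
  assumes M: "subspace M" "closed M"
  obtains p where "p \<in> M" "\<And>m. m \<in> M \<Longrightarrow> inner (x - p) m = 0"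
proof -
  define g where "g m = (norm (x - m))\<^sup>2" for m
  define d where "d = Inf (g ` M)"
  have ne: "M \<noteq> {}"
    using M subspace_0 by blast
  have bdd: "bdd_below (g ` M)"
    by (auto simp: g_def intro!: bdd_belowI[of _ 0])
  have d_le: "d \<le> g m" if "m \<in> M" for m
    unfolding d_def using bdd that by (auto intro: cInf_lower)
  \<comment> \<open>Nested closed sets of near-minimisers. Their diameters tend to 0, so by
    completeness they share a point, which attains the infimum.\<close>
  define S where "S n = {m \<in> M. g m \<le> d + inverse (real (Suc n))}" for n
  have cont: "continuous_on UNIV g"
    unfolding g_def by (intro continuous_intros)
  obtain p where p: "\<And>n. p \<in> S n"
  proof (rule decreasing_closed_nest[of S])
    show "closed (S n)" for n
      unfolding S_def Collect_conj_eq
      using M cont by (auto intro!: closed_Int closed_Collect_le continuous_intros)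
    show "S n \<noteq> {}" for n
    proof -
      have "Inf (g ` M) < d + inverse (real (Suc n))"
        by (simp add: d_def)
      then show ?thesis
        using cInf_lessD[of "g ` M"] ne by (auto simp: S_def intro: less_imp_le)
    qed
    show "S n \<subseteq> S m" if "m \<le> n" for m n
    proof -
      have "inverse (real (Suc n)) \<le> inverse (real (Suc m))"
        using that by (intro le_imp_inverse_le) auto
      then show ?thesis
        unfolding S_def by (auto simp del: of_nat_Suc intro: order_trans)
    qed
    show "\<exists>n. \<forall>a\<in>S n. \<forall>b\<in>S n. dist a b < e" if "e > 0" for e
    proof -
      have "e\<^sup>2 / 4 > 0"
        using that by simp
      then obtain n where n: "inverse (real (Suc n)) < e\<^sup>2 / 4"
        using reals_Archimedean by blast
      have "dist a b < e" if ab: "a \<in> S n" "b \<in> S n" for a b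
      proof -
        have "(1/2) *\<^sub>R (a + b) \<in> M"
          using ab M by (auto simp: S_def intro!: subspace_scale subspace_add)
        then have "d \<le> g ((1/2) *\<^sub>R (a + b))"
          by (rule d_le)
        \<comment> \<open>Parallelogram law for \<open>x - a\<close> and \<open>x - b\<close>. As
          the midpoint has \<open>g\<close> at least \<open>d\<close>, the right side is at most
          four times the slack \<open>inverse (real (Suc n))\<close>, hence the choice of
          \<open>n\<close>.\<close>
        moreover have "(norm (a - b))\<^sup>2 = 2 * g a + 2 * g b - 4 * g ((1/2) *\<^sub>R (a + b))"
          by (simp add: g_def power2_norm_eq_inner inner_diff_left inner_diff_right
              inner_add_left inner_add_right inner_commute algebra_simps)
        ultimately have "(norm (a - b))\<^sup>2 < e\<^sup>2"
          using ab n by (auto simp: S_def)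
        then show ?thesis
          using \<open>e > 0\<close> by (simp add: dist_norm power_less_imp_less_base)
      qed
      then show ?thesis
        by blast
    qed
  qed blast
  then have pM: "p \<in> M"
    by (auto simp: S_def)
  have "g p \<le> d"
  proof (rule field_le_epsilon)
    fix e :: real
    assume "e > 0"
    then obtain n where "inverse (real (Suc n)) < e"
      using reals_Archimedean by blast
    then show "g p \<le> d + e"
      using p[of n] by (auto simp: S_def)
  qed
  then have min: "g p \<le> g m" if "m \<in> M" for m
    using d_le[OF that] by simp
  have "inner (x - p) m = 0" if m: "m \<in> M" for m
  proof (cases "m = 0")
    case False
    define c where "c = inner (x - p) m"
    \<comment> \<open>This \<open>t\<close> minimises the quadratic
      \<open>g (p + t *\<^sub>R m)\<close>. The value there is \<open>g p - t * c\<close>, so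
      minimality of \<open>g p\<close> forces \<open>t = 0\<close> and then
      \<open>c = 0\<close>.\<close>
    define t where "t = c / inner m m"
    have tm: "t * inner m m = c"
      using False by (simp add: t_def)
    have "g (p + t *\<^sub>R m) = g p - 2 * t * c + t * (t * inner m m)"
      by (simp add: g_def c_def power2_norm_eq_inner inner_diff_left inner_diff_right
          inner_add_left inner_add_right inner_commute algebra_simps)
    moreover have "g p \<le> g (p + t *\<^sub>R m)"
      using m pM M by (intro min subspace_add subspace_scale)
    ultimately have "t * c \<le> 0"
      by (simp add: tm mult.commute)
    then have "t * t * inner m m \<le> 0"
      by (simp add: tm mult.assoc)
    then have "t = 0"
      using False by (smt (verit) inner_gt_zero_iff mult_le_0_iff zero_less_mult_iff
          linorder_neqE_linordered_idom)
    then show ?thesis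
      using tm by (simp add: c_def)
  qed simp
  then show ?thesis
    using that pM by blast
qed

section \<open>Operators and adjoints\<close>

lemma norm_scaleC: "norm (c *\<^sub>C x) = cmod c * norm x"
  for x :: "'a::complex_inner"
proof -
  have "complex_of_real ((norm (c *\<^sub>C x))\<^sup>2) = c * cnj c * complex_of_real ((norm x)\<^sup>2)"
    by (simp only: cinner_self[symmetric] cinner_scaleC_left cinner_scaleC_right
        mult.assoc mult.left_commute)
  also have "\<dots> = complex_of_real ((cmod c * norm x)\<^sup>2)"
    by (simp add: complex_norm_square[symmetric] power_mult_distrib)
  finally have "(norm (c *\<^sub>C x))\<^sup>2 = (cmod c * norm x)\<^sup>2"
    using of_real_eq_iff by blast
  then show ?thesis
    by (simp add: power2_eq_iff_nonneg)
qed

lemma bounded_linear_scaleC: "bounded_linear (\<lambda>x. c *\<^sub>C x)"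
  for c :: complex
  by (rule bounded_linear_intro[where K = "cmod c"])
    (simp_all add: scaleC_add_right scaleR_scaleC scaleC_scaleC norm_scaleC mult.commute)

lemma csubspace_imp_subspace: "csubspace M \<Longrightarrow> subspace M"
  by (simp add: csubspace_def subspace_def scaleR_scaleC)

lemma csubspace_closure:
  assumes "csubspace M"
  shows "csubspace (closure M)"
  unfolding csubspace_def
proof (intro conjI ballI allI)
  show "0 \<in> closure M"
    using assms closure_subset[of M] by (auto simp: csubspace_def)
next
  fix x y
  assume "x \<in> closure M" "y \<in> closure M"
  then obtain f g where "\<And>n. f n \<in> M" "\<And>n. g n \<in> M" "f \<longlonglongrightarrow> x" "g \<longlonglongrightarrow> y"
    unfolding closure_sequential by blast
  then show "x + y \<in> closure M"
    unfolding closure_sequential using assms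
    by (intro exI[of _ "\<lambda>n. f n + g n"]) (simp add: csubspace_def tendsto_add)
next
  fix c x
  assume "x \<in> closure M"
  then obtain f where "\<And>n. f n \<in> M" "f \<longlonglongrightarrow> x"
    unfolding closure_sequential by blast
  then show "c *\<^sub>C x \<in> closure M"
    unfolding closure_sequential using assms
    by (intro exI[of _ "\<lambda>n. c *\<^sub>C f n"])
      (simp add: csubspace_def bounded_linear.tendsto[OF bounded_linear_scaleC])
qed

lemma bounded_ops_diff:
  assumes "S \<in> bounded_ops" "T \<in> bounded_ops"
  shows "(\<lambda>x. S x - T x) \<in> bounded_ops"
proof -
  have "c *\<^sub>C (x - y) = c *\<^sub>C x - c *\<^sub>C y" for c and x y :: 'a
    by (rule linear_simps(2)[OF bounded_linear_scaleC])
  then show ?thesis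
    using assms by (auto simp: bounded_ops_def intro: bounded_linear_sub)
qed

lemma csubspace_range:
  assumes "T \<in> bounded_ops"
  shows "csubspace (range T)"
proof -
  interpret bounded_linear T
    using assms by (simp add: bounded_ops_def)
  have "T x + T y \<in> range T" "c *\<^sub>C T x \<in> range T" "0 \<in> range T" for c x y
    using assms rangeI[of T "x + y"] rangeI[of T "c *\<^sub>C x"] rangeI[of T 0]
    by (simp_all only: add zero bounded_ops_def mem_Collect_eq)
  then show ?thesis
    unfolding csubspace_def by fast
qed

lemma cadjoint_eqI:
  assumes "T \<in> bounded_ops" "\<And>x y. cinner (T x) y = cinner x (S y)"
  shows "cadjoint T = S"
proof (rule ext, rule cinner_right_eqI)
  show "cinner x (cadjoint T y) = cinner x (S y)" for x y
    using cadjoint[OF assms(1), of x y] assms(2)[of x y] by simp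
qed

lemma cadjoint_comp:
  assumes "S \<in> bounded_ops" "T \<in> bounded_ops" "S \<circ> T \<in> bounded_ops"
  shows "cadjoint (S \<circ> T) = cadjoint T \<circ> cadjoint S"
  by (rule cadjoint_eqI) (use assms in \<open>simp_all add: cadjoint\<close>)

lemma cadjoint_cadjoint:
  assumes "T \<in> bounded_ops"
  shows "cadjoint (cadjoint T) = T"
  by (rule cadjoint_eqI)
    (use assms in \<open>metis cadjoint cadjoint_in_bounded_ops cinner_commute\<close>)+

lemma inner_cadjoint:
  assumes "T \<in> bounded_ops"
  shows "inner (T x) y = inner x (cadjoint T y)"
  using cadjoint[OF assms] by (simp add: inner_eq_Re_cinner)

section \<open>Douglas factorisation\<close>

text \<open>Majorisation half of Douglas' theorem. Normalising the functionals
  \<open>inner x (cadjoint A z)\<close> by \<open>norm (cadjoint B z)\<close> gives a family indexed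
  by \<open>z\<close>; writing \<open>A x = B w\<close> bounds it at \<open>x\<close> by
  \<open>norm w\<close>, which does not depend on \<open>z\<close>. Uniform boundedness then
  supplies \<open>C\<close>.\<close>

lemma range_subset_imp_cadjoint_bound:
  fixes A B :: "'h::complex_hilbert_space \<Rightarrow> 'h"
  assumes A: "A \<in> bounded_ops" and B: "B \<in> bounded_ops" and sub: "range A \<subseteq> range B"
  obtains C where "C \<ge> 0" "\<And>z. norm (cadjoint A z) \<le> C * norm (cadjoint B z)"
proof -
  have eq: "\<exists>w. \<forall>z. inner x (cadjoint A z) = inner w (cadjoint B z)" for x
  proof -
    obtain w where "A x = B w"
      using sub by blast
    then show ?thesis
      by (metis A B inner_cadjoint)
  qed
  \<comment> \<open>\<open>f z\<close> vanishes if \<open>cadjoint B z = 0\<close>, by the convention \<open>r / 0 = 0\<close>.\<close>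
  define f where "f z x = inner x (cadjoint A z) / norm (cadjoint B z)" for x z
  have lin: "bounded_linear (f z)" for z
    unfolding f_def divide_inverse
    by (intro bounded_linear_mult_const bounded_linear_inner_left)
  have "\<exists>K. \<forall>z. norm (f z x) \<le> K" for x
  proof -
    obtain w where w: "\<And>z. inner x (cadjoint A z) = inner w (cadjoint B z)"
      using eq by blast
    have "norm (f z x) \<le> norm w" for z
      using Cauchy_Schwarz_ineq2[of w "cadjoint B z"]
      by (cases "cadjoint B z = 0") (auto simp: f_def w divide_le_eq)
    then show ?thesis
      by blast
  qed
  then obtain C where C: "C \<ge> 0" "\<And>z x. norm (f z x) \<le> C * norm x"
    using uniform_boundedness[of f, OF lin] by blast
  have "norm (cadjoint A z) \<le> C * norm (cadjoint B z)" for z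
  proof (cases "cadjoint A z = 0")
    case True
    then show ?thesis
      using C by simp
  next
    case False
    \<comment> \<open>If \<open>cadjoint B z\<close> were 0, then \<open>eq\<close> at the point
      \<open>cadjoint A z\<close> would make the inner product of this vector with itself
      vanish.\<close>
    have "cadjoint B z \<noteq> 0"
      using eq[of "cadjoint A z"] False by (metis inner_eq_zero_iff inner_zero_right)
    then have "(norm (cadjoint A z))\<^sup>2 \<le> C * norm (cadjoint A z) * norm (cadjoint B z)"
      using C(2)[of z "cadjoint A z"]
      by (simp add: f_def divide_le_eq power2_norm_eq_inner)
    then show ?thesis
      using False by (simp add: power2_eq_square mult.assoc mult.left_commute)
  qed
  then show ?thesis
    using that C by blast
qed

text \<open>Among the solutions \<open>p\<close> of \<open>B p = A x\<close>, exactly one lies in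
  the closure of the range of \<open>cadjoint B\<close>; \<open>X\<close> selects it. The last two
  conclusions record this choice, so that identities for \<open>X\<close> can be checked after
  applying \<open>B\<close>.\<close>

lemma douglas_factorization:
  fixes A B :: "'h::complex_hilbert_space \<Rightarrow> 'h"
  assumes A: "A \<in> bounded_ops" and B: "B \<in> bounded_ops" and sub: "range A \<subseteq> range B"
  obtains X where "X \<in> bounded_ops" "B \<circ> X = A" "range X \<subseteq> closure (range (cadjoint B))"
    "inj_on B (closure (range (cadjoint B)))"
proof -
  define M where "M = closure (range (cadjoint B))"
  have csM: "csubspace M"
    unfolding M_def by (intro csubspace_closure csubspace_range cadjoint_in_bounded_ops B)
  then have sM: "subspace M"
    by (rule csubspace_imp_subspace)
  interpret A: bounded_linear A
    using A by (simp add: bounded_ops_def)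
  interpret B: bounded_linear B
    using B by (simp add: bounded_ops_def)
  have AC: "A (c *\<^sub>C x) = c *\<^sub>C A x" and BC: "B (c *\<^sub>C x) = c *\<^sub>C B x" for c x
    using A B by (auto simp: bounded_ops_def)
  have inj: "inj_on B M"
  proof (rule inj_onI)
    fix x y
    assume xy: "x \<in> M" "y \<in> M" "B x = B y"
    \<comment> \<open>The kernel of \<open>B\<close> is orthogonal to \<open>M\<close>; since
      \<open>x - y\<close> lies in both, it is orthogonal to itself.\<close>
    have "M \<subseteq> {m. inner (x - y) m = 0}"
      unfolding M_def
    proof (rule closure_minimal)
      show "range (cadjoint B) \<subseteq> {m. inner (x - y) m = 0}"
        using xy by (auto simp: inner_cadjoint[OF B, symmetric] B.diff)
      show "closed {m. inner (x - y) m = 0}"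
        by (intro closed_Collect_eq continuous_intros)
    qed
    moreover have "x - y \<in> M"
      using xy sM by (simp add: subspace_diff)
    ultimately show "x = y"
      by (auto dest!: subsetD)
  qed
  have "\<exists>p\<in>M. B p = A x" for x
  proof -
    obtain w where w: "A x = B w"
      using sub by blast
    \<comment> \<open>Projecting a preimage \<open>w\<close> onto \<open>M\<close> keeps its image
      under \<open>B\<close>: the remainder \<open>w - p\<close> is orthogonal to every
      \<open>cadjoint B y\<close>, hence in the kernel of \<open>B\<close>.\<close>
    obtain p where p: "p \<in> M" "\<And>m. m \<in> M \<Longrightarrow> inner (w - p) m = 0"
      using orthogonal_projection_exists[OF sM, of w] by (auto simp: M_def)
    have "inner (B (w - p)) y = 0" for y
      using p(2)[of "cadjoint B y"] closure_subset[of "range (cadjoint B)"]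
      by (auto simp: inner_cadjoint[OF B] M_def)
    then have "B (w - p) = 0"
      using inner_eq_zero_iff by blast
    then show ?thesis
      using p w by (auto simp: B.diff)
  qed
  then obtain X where X: "\<And>x. X x \<in> M" "\<And>x. B (X x) = A x"
    by metis
  obtain C where C: "C \<ge> 0" "\<And>z. norm (cadjoint A z) \<le> C * norm (cadjoint B z)"
    using range_subset_imp_cadjoint_bound[OF A B sub] by blast
  \<comment> \<open>Both sides lie in \<open>M\<close> and have the same image under
    \<open>B\<close>, so injectivity on \<open>M\<close> makes the selection linear.\<close>
  have add: "X (x + y) = X x + X y" for x y
    by (rule inj_onD[OF inj]) (use csM in \<open>simp_all add: X csubspace_def B.add A.add\<close>)
  have scale: "X (c *\<^sub>C x) = c *\<^sub>C X x" for c x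
    by (rule inj_onD[OF inj]) (use csM in \<open>simp_all add: X csubspace_def AC BC\<close>)
  have bound: "norm (X x) \<le> norm x * C" for x
  proof -
    \<comment> \<open>The adjoint bound gives the estimate on the range of
      \<open>cadjoint B\<close>; it passes to the closure \<open>M\<close> and may then be tested at
      \<open>m = X x\<close>.\<close>
    have "M \<subseteq> {m. inner (X x) m \<le> norm x * C * norm m}"
      unfolding M_def
    proof (rule closure_minimal)
      show "closed {m. inner (X x) m \<le> norm x * C * norm m}"
        by (intro closed_Collect_le continuous_intros)
      have "inner (X x) (cadjoint B z) \<le> norm x * C * norm (cadjoint B z)" for z
      proof -
        have "inner (X x) (cadjoint B z) = inner x (cadjoint A z)"
          by (simp add: inner_cadjoint[OF B, symmetric] inner_cadjoint[OF A, symmetric] X)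
        also have "\<dots> \<le> norm x * norm (cadjoint A z)"
          by (rule norm_cauchy_schwarz)
        also have "\<dots> \<le> norm x * (C * norm (cadjoint B z))"
          by (intro mult_left_mono C) simp
        finally show ?thesis
          by (simp add: mult.assoc)
      qed
      then show "range (cadjoint B) \<subseteq> {m. inner (X x) m \<le> norm x * C * norm m}"
        by auto
    qed
    then have "norm (X x) * norm (X x) \<le> norm x * C * norm (X x)"
      using X(1)[of x] by (auto simp: power2_norm_eq_inner simp flip: power2_eq_square)
    then show ?thesis
      using C(1) by (cases "X x = 0") auto
  qed
  have "bounded_linear X"
    by (rule bounded_linear_intro[where K = C]) (simp_all add: add scale scaleR_scaleC bound)
  then have "X \<in> bounded_ops"
    by (simp add: bounded_ops_def scale)
  moreover have "B \<circ> X = A" "range X \<subseteq> M"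
    using X by auto
  ultimately show ?thesis
    using that inj unfolding M_def by blast
qed

section \<open>The minus order\<close>

text \<open>Each range decomposition yields one idempotent, acting on the adjoint side:
  \<open>Q\<close> is the adjoint of the Douglas factor \<open>X\<close>.\<close>

lemma is_direct_sum_imp_idempotent:
  fixes A B :: "'h::complex_hilbert_space \<Rightarrow> 'h"
  assumes A: "A \<in> bounded_ops" and B: "B \<in> bounded_ops"
    and sum: "is_direct_sum (range B) (range A) (range (\<lambda>x. B x - A x))"
  obtains Q where "Q \<in> bounded_ops" "Q \<circ> Q = Q" "cadjoint A = Q \<circ> cadjoint B"
proof -
  let ?D = "\<lambda>x. B x - A x"
  interpret A: bounded_linear A
    using A by (simp add: bounded_ops_def)
  interpret B: bounded_linear B
    using B by (simp add: bounded_ops_def)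
  have "range A \<subseteq> range B"
  proof
    fix y
    assume "y \<in> range A"
    moreover have "0 \<in> range ?D"
      using sum by (simp add: is_direct_sum_def csubspace_def)
    ultimately have "y + 0 \<in> range A + range ?D"
      by (rule set_plus_intro)
    then show "y \<in> range B"
      using sum by (simp add: is_direct_sum_def)
  qed
  then obtain X where X: "X \<in> bounded_ops" "B \<circ> X = A" "range X \<subseteq> closure (range (cadjoint B))"
    and inj: "inj_on B (closure (range (cadjoint B)))"
    using douglas_factorization[OF A B] by blast
  have BX: "B (X x) = A x" for x
    using X(2) by (auto simp: fun_eq_iff)
  have AX: "A (X x) = A x" for x
  proof -
    \<comment> \<open>Since \<open>A x = B (X x)\<close>, this vector is a value of \<open>A\<close>
      and of \<open>B - A\<close> at once, and the trivial intersection kills it.\<close>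
    have "A (x - X x) = ?D (X x)"
      by (simp add: A.diff BX)
    then have "A (x - X x) \<in> range A \<inter> range ?D"
      by blast
    then have "A (x - X x) = 0"
      using sum unfolding is_direct_sum_def by blast
    then show ?thesis
      by (simp add: A.diff)
  qed
  have idem: "X \<circ> X = X"
  proof (rule ext, rule inj_onD[OF inj])
    fix x
    show "B ((X \<circ> X) x) = B (X x)"
      by (simp add: BX AX)
  qed (use X(3) in auto)
  have "cadjoint X \<circ> cadjoint X = cadjoint X"
    using cadjoint_comp[of X X] X idem by simp
  moreover have "cadjoint A = cadjoint X \<circ> cadjoint B"
    using cadjoint_comp[OF B X(1)] X A by simp
  ultimately show ?thesis
    using that cadjoint_in_bounded_ops X by blast
qed

text \<open>\<open>P\<close> fixes the range of \<open>A = P \<circ> B\<close> and annihilates that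
  of \<open>B - A\<close>, so the two meet only in 0. The inclusion \<open>sub\<close> does not
  follow from the factorisation through \<open>P\<close>; the other idempotent provides it.\<close>

lemma idempotent_imp_is_direct_sum:
  fixes A B P :: "'h::complex_hilbert_space \<Rightarrow> 'h"
  assumes A: "A \<in> bounded_ops" and B: "B \<in> bounded_ops" and P: "P \<in> bounded_ops"
    and idem: "P \<circ> P = P" and eq: "A = P \<circ> B" and sub: "range A \<subseteq> range B"
  shows "is_direct_sum (range B) (range A) (range (\<lambda>x. B x - A x))"
proof -
  let ?D = "\<lambda>x. B x - A x"
  interpret P: bounded_linear P
    using P by (simp add: bounded_ops_def)
  have PP: "P (P x) = P x" for x
    using idem by (auto simp: fun_eq_iff)
  have cs: "csubspace (range A)" "csubspace (range ?D)" "csubspace (range B)"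
    using A B by (auto intro: csubspace_range bounded_ops_diff)
  have D: "range ?D \<subseteq> range B"
    using sub subspace_diff[OF csubspace_imp_subspace[OF cs(3)]] by blast
  have "range B = range A + range ?D"
  proof
    show "range B \<subseteq> range A + range ?D"
    proof
      fix y
      assume "y \<in> range B"
      then obtain x where x: "y = A x + ?D x"
        by auto
      show "y \<in> range A + range ?D"
        unfolding x by (intro set_plus_intro rangeI)
    qed
    show "range A + range ?D \<subseteq> range B"
    proof
      fix y
      assume "y \<in> range A + range ?D"
      then obtain u v where "u \<in> range A" "v \<in> range ?D" "y = u + v"
        by (rule set_plus_elim)
      then show "y \<in> range B"
        using cs(3) subsetD[OF sub] subsetD[OF D] unfolding csubspace_def by blast
    qed
  qed
  moreover have "range A \<inter> range ?D = {0}"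
  proof -
    have "v = 0" if "v \<in> range A" "v \<in> range ?D" for v
    proof -
      have "P v = v"
        using that(1) by (auto simp: eq PP)
      moreover have "P v = 0"
        using that(2) by (auto simp: eq P.diff PP)
      ultimately show ?thesis
        by simp
    qed
    then show ?thesis
      using cs by (auto simp: csubspace_def)
  qed
  ultimately show ?thesis
    using cs by (simp add: is_direct_sum_def)
qed

text \<open>Taking adjoints turns the left factor \<open>Q\<close> of \<open>cadjoint B\<close> into
  a right factor of \<open>B\<close>, namely \<open>cadjoint Q\<close>.\<close>

lemma cadjoint_factor_imp_range_subset:
  assumes "A \<in> bounded_ops" "B \<in> bounded_ops" "Q \<in> bounded_ops" "cadjoint A = Q \<circ> cadjoint B"
  shows "range A \<subseteq> range B"
proof -
  have "A = B \<circ> cadjoint Q"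
    using cadjoint_comp[of Q "cadjoint B"] assms by (metis cadjoint_cadjoint cadjoint_in_bounded_ops)
  then show ?thesis
    by auto
qed

theorem theorem3p3:
  fixes A B :: "'h::complex_hilbert_space \<Rightarrow> 'h"
  assumes "A \<in> bounded_ops" and "B \<in> bounded_ops"
  shows "minus_le A B \<longleftrightarrow>
    is_direct_sum (range B) (range A) (range (\<lambda>x. B x - A x)) \<and>
    is_direct_sum (range (cadjoint B)) (range (cadjoint A))
      (range (\<lambda>x. cadjoint B x - cadjoint A x))"
proof -
  note adj = assms[THEN cadjoint_in_bounded_ops]
  note adj2 = assms[THEN cadjoint_cadjoint]
  show ?thesis
  proof
    assume "minus_le A B"
    then obtain P Q where PQ: "P \<in> bounded_ops" "Q \<in> bounded_ops" "P \<circ> P = P" "Q \<circ> Q = Q"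
      "A = P \<circ> B" "cadjoint A = Q \<circ> cadjoint B"
      by (auto simp: minus_le_def)
    \<comment> \<open>The roles cross: \<open>Q\<close> gives the inclusion for the ranges of
      \<open>A\<close> and \<open>B\<close>, while \<open>P\<close> gives the one for their
      adjoints.\<close>
    have "range A \<subseteq> range B"
      using assms PQ(2,6) by (rule cadjoint_factor_imp_range_subset)
    moreover have "range (cadjoint A) \<subseteq> range (cadjoint B)"
      using adj PQ(1) by (rule cadjoint_factor_imp_range_subset) (simp only: adj2 PQ(5)[symmetric])
    ultimately show "is_direct_sum (range B) (range A) (range (\<lambda>x. B x - A x)) \<and>
        is_direct_sum (range (cadjoint B)) (range (cadjoint A))
          (range (\<lambda>x. cadjoint B x - cadjoint A x))"
      using idempotent_imp_is_direct_sum[OF assms PQ(1,3,5)]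
        idempotent_imp_is_direct_sum[OF adj PQ(2,4,6)] by blast
  next
    assume sum: "is_direct_sum (range B) (range A) (range (\<lambda>x. B x - A x)) \<and>
      is_direct_sum (range (cadjoint B)) (range (cadjoint A))
        (range (\<lambda>x. cadjoint B x - cadjoint A x))"
    obtain Q where "Q \<in> bounded_ops" "Q \<circ> Q = Q" "cadjoint A = Q \<circ> cadjoint B"
      using is_direct_sum_imp_idempotent[OF assms] sum by blast
    \<comment> \<open>For the adjoint pair the factorisation is one of double adjoints, which
      \<open>adj2\<close> turns into \<open>A = P \<circ> B\<close>.\<close>
    moreover obtain P where "P \<in> bounded_ops" "P \<circ> P = P"
      "cadjoint (cadjoint A) = P \<circ> cadjoint (cadjoint B)"
      using is_direct_sum_imp_idempotent[OF adj] sum by blast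
    ultimately show "minus_le A B"
      unfolding minus_le_def adj2 by blast
  qed
qed

end
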